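(* Let $b\colon(0,\infty)\to[0,\infty)$ be a nonincreasing function that is not identically zero. Let $Y$ be a quasinormed rearrangement-invariant space such that $\min\{1,b\}\in Y$. Then $T_b\colon\Upsilon_{b,Y}\to Y$. Furthermore, the space $\Upsilon_{b,Y}$ is the optimal domain partner of $Y$ with respect to $T_b$ (in the class of quasinormed rearrangement-invariant spaces). Moreover, if $Y$ is a quasinormed rearrangement-invariant space with $\min\{1,b\}\notin Y$, then there is no domain partner of $Y$ with respect to $T_b$ in the class of quasinormed rearrangement-invariant spaces.
   Context: $\mathcal M(0,\infty)$ is the set of Lebesgue measurable $f\colon(0,\infty)\to[-\infty,\infty]$ and $\mathcal M_+(0,\infty)$ the subset of $[0,\infty]$-valued functions; $\lambda$ is Lebesgue measure. The nonincreasing rearrangement of $f$ is $f^*(x):=\inf\{t\in[0,\infty):\lambda(\{|f|>t\})\le x\}$, $x\in[0,\infty)$. A rearrangement-invariant quasinorm is a functional $\rho\colon\mathcal M_+(0,\infty)\to[0,\infty]$ such that for all $f,g,f_j\in\mathcal M_+(0,\infty)$ and $a\in[0,\infty)$: (Q1) $\rho(f)=0$ iff $f=0$ a.e., $\rho(af)=a\rho(f)$, and $\rho(f+g)\le C(\rho(f)+\rho(g))$ with a constant $C\in[1,\infty)$ independent of $f,g$; (P2) $f\le g$ a.e. implies $\rho(f)\le\rho(g)$; (P3) $f_j\nearrow f$ a.e. implies $\rho(f_j)\nearrow\rho(f)$; (P4) $\rho(\chi_G)<\infty$ for every $G\subset(0,\infty)$ of finite measure; (P6) $\rho(f)=\rho(g)$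 whenever $f^*=g^*$. The corresponding quasinormed rearrangement-invariant space is $X=\{f\in\mathcal M(0,\infty):\rho(|f|)<\infty\}$, with $\|f\|_X:=\rho(|f|)$ for $f\in\mathcal M(0,\infty)$. For $b$ as in the claim, $T_bf(t):=\int_0^{b(t)}f^*$, $t\in(0,\infty)$, $f\in\mathcal M(0,\infty)$. If $\min\{1,b\}\in Y$, then $\Upsilon_{b,Y}:=\{f\in\mathcal M(0,\infty):\|T_bf\|_Y<\infty\}$ with $\|f\|_{\Upsilon_{b,Y}}:=\|T_bf\|_Y$ (this is a quasinormed rearrangement-invariant space). $T\colon X\to Y$ means that $T$ is bounded: there is $C\in(0,\infty)$ with $\|Tf\|_Y\le C\|f\|_X$ for all $f\in X$. $Z\hookrightarrow X$ means there is $C\in(0,\infty)$ with $\|f\|_X\le C\|f\|_Z$ for all $f\in Z$. $X$ is a domain partner of $Y$ with respect to $T$ if $T\colon X\to Y$; it is the optimal domain partner if it is a domain partner and $Z\hookrightarrow X$ for every domain partner $Z$ of $Y$ with respect to $T$ (within the considered class of spaces). *)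

theory Defs
  imports "HOL-Analysis.Analysis"
begin

abbreviation half_line :: "real measure" where
  "half_line \<equiv> lebesgue_on {0<..}"

text \<open>
  Functions on the open half-line are represented by functions on all of \<^typ>\<open>real\<close>; their values
  at nonpositive arguments are irrelevant, because measurability, level sets and
  ``almost everywhere'' are always taken with respect to \<^const>\<open>lebesgue_on\<close> \<open>{0<..}\<close>.
\<close>

definition meas_fun :: "(real \<Rightarrow> ereal) set" where
  "meas_fun = borel_measurable half_line"

definition meas_fun_nonneg :: "(real \<Rightarrow> ereal) set" where
  "meas_fun_nonneg = {f \<in> meas_fun. \<forall>x>0. 0 \<le> f x}"

text \<open>The infimum of the empty set is \<open>\<infinity>\<close>. Only arguments \<open>x \<ge> 0\<close> are meaningful.\<close>

definition rearr :: "(real \<Rightarrow> ereal) \<Rightarrow> real \<Rightarrow> ennreal" where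
  "rearr f x =
    (INF t \<in> {t::real. 0 \<le> t \<and> emeasure half_line {s \<in> {0<..}. ereal t < \<bar>f s\<bar>} \<le> ennreal x}. ennreal t)"

definition ri_quasinorm :: "((real \<Rightarrow> ereal) \<Rightarrow> ennreal) \<Rightarrow> bool" where
  "ri_quasinorm \<rho> \<longleftrightarrow>
    (\<forall>f\<in>meas_fun_nonneg. \<rho> f = 0 \<longleftrightarrow> (AE x in half_line. f x = 0)) \<and>
    (\<forall>f\<in>meas_fun_nonneg. \<forall>a::real. 0 \<le> a \<longrightarrow> \<rho> (\<lambda>x. ereal a * f x) = ennreal a * \<rho> f) \<and>
    (\<exists>C::real. 1 \<le> C \<and> (\<forall>f\<in>meas_fun_nonneg. \<forall>g\<in>meas_fun_nonneg.
        \<rho> (\<lambda>x. f x + g x) \<le> ennreal C * (\<rho> f + \<rho> g))) \<and>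
    (\<forall>f\<in>meas_fun_nonneg. \<forall>g\<in>meas_fun_nonneg.
        (AE x in half_line. f x \<le> g x) \<longrightarrow> \<rho> f \<le> \<rho> g) \<and>
    (\<forall>F f. (\<forall>j::nat. F j \<in> meas_fun_nonneg) \<longrightarrow> f \<in> meas_fun_nonneg \<longrightarrow>
        (AE x in half_line. incseq (\<lambda>j. F j x) \<and> (\<lambda>j. F j x) \<longlonglongrightarrow> f x) \<longrightarrow>
        incseq (\<lambda>j. \<rho> (F j)) \<and> (\<lambda>j. \<rho> (F j)) \<longlonglongrightarrow> \<rho> f) \<and>
    (\<forall>G\<in>sets half_line. emeasure half_line G < \<infinity> \<longrightarrow> \<rho> (indicator G) < \<infinity>) \<and>
    (\<forall>f\<in>meas_fun_nonneg. \<forall>g\<in>meas_fun_nonneg.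
        (\<forall>x\<ge>0. rearr f x = rearr g x) \<longrightarrow> \<rho> f = \<rho> g)"

text \<open>
  A function space is its underlying set together with its functional, which is defined (possibly
  infinite) on all of \<open>meas_fun\<close>.
\<close>

record fun_space =
  space_set :: "(real \<Rightarrow> ereal) set"
  space_norm :: "(real \<Rightarrow> ereal) \<Rightarrow> ennreal"

definition qri_space :: "fun_space \<Rightarrow> bool" where
  "qri_space X \<longleftrightarrow> (\<exists>\<rho>. ri_quasinorm \<rho> \<and>
    space_set X = {f \<in> meas_fun. \<rho> (\<lambda>x. \<bar>f x\<bar>) < \<infinity>} \<and>
    (\<forall>f\<in>meas_fun. space_norm X f = \<rho> (\<lambda>x. \<bar>f x\<bar>)))"

definition bounded_between ::
  "((real \<Rightarrow> ereal) \<Rightarrow> (real \<Rightarrow> ereal)) \<Rightarrow> fun_space \<Rightarrow> fun_space \<Rightarrow> bool" where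
  "bounded_between T X Y \<longleftrightarrow>
    (\<exists>C::real. 0 < C \<and> (\<forall>f\<in>space_set X. space_norm Y (T f) \<le> ennreal C * space_norm X f))"

definition embeds :: "fun_space \<Rightarrow> fun_space \<Rightarrow> bool" where
  "embeds Z X \<longleftrightarrow>
    (\<exists>C::real. 0 < C \<and> (\<forall>f\<in>space_set Z. space_norm X f \<le> ennreal C * space_norm Z f))"

text \<open>Domain partners are always taken in the class of quasinormed rearrangement-invariant spaces.\<close>

definition domain_partner ::
  "((real \<Rightarrow> ereal) \<Rightarrow> (real \<Rightarrow> ereal)) \<Rightarrow> fun_space \<Rightarrow> fun_space \<Rightarrow> bool" where
  "domain_partner T Y X \<longleftrightarrow> qri_space X \<and> bounded_between T X Y"

definition optimal_domain_partner ::
  "((real \<Rightarrow> ereal) \<Rightarrow> (real \<Rightarrow> ereal)) \<Rightarrow> fun_space \<Rightarrow> fun_space \<Rightarrow> bool" where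
  "optimal_domain_partner T Y X \<longleftrightarrow>
    domain_partner T Y X \<and> (\<forall>Z. domain_partner T Y Z \<longrightarrow> embeds Z X)"

definition T_op :: "(real \<Rightarrow> real) \<Rightarrow> (real \<Rightarrow> ereal) \<Rightarrow> (real \<Rightarrow> ereal)" where
  "T_op b f = (\<lambda>t. enn2ereal (\<integral>\<^sup>+ s\<in>{0<..<b t}. rearr f s \<partial>lebesgue))"

definition Upsilon :: "(real \<Rightarrow> real) \<Rightarrow> fun_space \<Rightarrow> fun_space" where
  "Upsilon b Y = \<lparr>
    space_set = {f \<in> meas_fun. space_norm Y (T_op b f) < \<infinity>},
    space_norm = (\<lambda>f. space_norm Y (T_op b f))\<rparr>"

end

theory Submission
  imports Defs
begin

text \<open>
  The rearrangement is the generalised inverse of the distribution function, so for \<open>c \<ge> 0\<close> one has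
  \<open>f\<^sup>*(x) \<le> c\<close> iff \<open>\<lambda>{\<bar>f\<bar> > c} \<le> x\<close>. This transfers monotonicity, homogeneity and monotone
  convergence from distribution functions to rearrangements, hence to \<open>T\<^sub>b\<close>, and gives
  \<open>(f + g)\<^sup>*(x) \<le> f\<^sup>*(x/2) + g\<^sup>*(x/2)\<close>, which after a change of variables yields the quasi-triangle
  inequality \<open>T\<^sub>b(f + g) \<le> 2 (T\<^sub>b f + T\<^sub>b g)\<close>. Indicators of finite measure are handled by
  \<open>T\<^sub>b \<chi>\<^sub>G = min {b, \<lambda>(G)}\<close>, which is comparable to \<open>min {1, b}\<close>; the same identity excludes domain
  partners when \<open>min {1, b} \<notin> Y\<close>. Optimality is immediate, since the norm of \<open>\<Upsilon>\<close> is the norm of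
  \<open>T\<^sub>b f\<close> in \<open>Y\<close>.
\<close>

section \<open>Distribution functions and the rearrangement as their generalised inverse\<close>

definition distr_fun :: "(real \<Rightarrow> ereal) \<Rightarrow> real \<Rightarrow> ennreal" where
  "distr_fun f c = emeasure half_line {s \<in> {0<..}. ereal c < \<bar>f s\<bar>}"

lemma space_half_line [simp]: "space half_line = {0<..}"
  by simp

lemma AE_half_lineI: "(\<And>x. 0 < x \<Longrightarrow> P x) \<Longrightarrow> AE x in half_line. P x"
  by (rule AE_I2) simp

text \<open>The set is written with \<open>0 < s\<close> because the simplifier turns
  \<open>s \<in> {0<..}\<close> into this form; the rule then fires on the level sets of
  \<open>distr_fun\<close>.\<close>

lemma level_set_measurable [simp]:
  "f \<in> meas_fun \<Longrightarrow> {s. 0 < s \<and> ereal c < \<bar>f s\<bar>} \<in> sets half_line"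
proof -
  assume "f \<in> meas_fun"
  then have [measurable]: "f \<in> borel_measurable half_line"
    by (simp add: meas_fun_def)
  have "{s \<in> space half_line. ereal c < \<bar>f s\<bar>} \<in> sets half_line"
    by measurable
  then show ?thesis
    by simp
qed

lemma meas_fun_nonnegD:
  assumes "f \<in> meas_fun_nonneg"
  shows "f \<in> meas_fun" "0 < x \<Longrightarrow> 0 \<le> f x"
  using assms by (auto simp: meas_fun_nonneg_def)

lemma distr_fun_antimono: "f \<in> meas_fun \<Longrightarrow> c \<le> d \<Longrightarrow> distr_fun f d \<le> distr_fun f c"
  unfolding distr_fun_def
  by (rule emeasure_mono) (auto intro: order.strict_trans1[of "ereal c" "ereal d"])

text \<open>Continuity of the measure from below: the level sets at height
  \<open>c + 1 / real (Suc n)\<close> increase to the level set at height \<open>c\<close>.\<close>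

lemma distr_fun_right_cont:
  assumes f: "f \<in> meas_fun"
  shows "distr_fun f c = (SUP n. distr_fun f (c + 1 / real (Suc n)))"
proof -
  let ?A = "\<lambda>n::nat. {s \<in> {0<..}. ereal (c + 1 / real (Suc n)) < \<bar>f s\<bar>}"
  have inc: "incseq ?A"
  proof (rule incseq_SucI)
    fix n
    have "ereal (c + 1 / real (Suc (Suc n))) \<le> ereal (c + 1 / real (Suc n))"
      by (simp add: frac_le)
    then show "?A n \<le> ?A (Suc n)"
      by (blast intro: order.strict_trans1)
  qed
  have "{s \<in> {0<..}. ereal c < \<bar>f s\<bar>} = (\<Union>n. ?A n)"
  proof (intro equalityI subsetI)
    fix s assume s: "s \<in> {s \<in> {0<..}. ereal c < \<bar>f s\<bar>}"
    \<comment> \<open>An intermediate real \<open>q\<close> is chosen since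
      \<open>\<bar>f s\<bar>\<close> may be infinite, while the Archimedean property needs a real
      gap.\<close>
    then obtain q where q: "ereal c < ereal q" "ereal q < \<bar>f s\<bar>"
      using ereal_dense2[of "ereal c" "\<bar>f s\<bar>"] by auto
    then obtain n where "inverse (real (Suc n)) < q - c"
      using reals_Archimedean[of "q - c"] by auto
    then have "ereal (c + 1 / real (Suc n)) < ereal q"
      by (simp add: inverse_eq_divide)
    then show "s \<in> (\<Union>n. ?A n)"
      using q s by (blast intro: order.strict_trans)
  next
    fix s assume "s \<in> (\<Union>n. ?A n)"
    then obtain n where n: "s > 0" "ereal (c + 1 / real (Suc n)) < \<bar>f s\<bar>"
      by auto
    have "ereal c \<le> ereal (c + 1 / real (Suc n))"
      by simp
    with n show "s \<in> {s \<in> {0<..}. ereal c < \<bar>f s\<bar>}"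
      by (blast intro: order.strict_trans1)
  qed
  moreover have "(SUP n. emeasure half_line (?A n)) = emeasure half_line (\<Union>n. ?A n)"
    by (rule SUP_emeasure_incseq) (use inc f in auto)
  ultimately show ?thesis
    by (simp add: distr_fun_def)
qed

text \<open>If the distribution function is small at \<open>c\<close>, then \<open>c\<close> itself
  competes in the infimum. Conversely, every \<open>c + 1 / real (Suc n)\<close> lies above some
  competitor, so the bound holds there, and right continuity carries it down to
  \<open>c\<close>.\<close>

lemma rearr_le_iff:
  assumes f: "f \<in> meas_fun" and c: "0 \<le> c"
  shows "rearr f x \<le> ennreal c \<longleftrightarrow> distr_fun f c \<le> ennreal x"
proof
  assume "distr_fun f c \<le> ennreal x"
  then show "rearr f x \<le> ennreal c"
    unfolding rearr_def by (intro INF_lower) (use c in \<open>auto simp: distr_fun_def\<close>)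
next
  assume le: "rearr f x \<le> ennreal c"
  have "distr_fun f (c + 1 / real (Suc n)) \<le> ennreal x" for n
  proof -
    have "ennreal c < ennreal (c + 1 / real (Suc n))"
      by (rule ennreal_lessI) (use c in \<open>auto intro: add_nonneg_pos\<close>)
    with le have "rearr f x < ennreal (c + 1 / real (Suc n))"
      by (rule order.strict_trans1)
    then obtain t where t: "0 \<le> t" "distr_fun f t \<le> ennreal x"
      "ennreal t < ennreal (c + 1 / real (Suc n))"
      unfolding rearr_def INF_less_iff distr_fun_def by auto
    then have "t \<le> c + 1 / real (Suc n)"
      by (simp add: ennreal_less_iff)
    then show ?thesis
      using distr_fun_antimono[OF f] t(2) by (blast intro: order_trans)
  qed
  then show "distr_fun f c \<le> ennreal x"
    by (subst distr_fun_right_cont[OF f]) (rule SUP_least)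
qed

text \<open>An infinite \<open>b\<close> leaves nothing to prove, so finite bounds suffice as tests.
  These are the only bounds that \<open>rearr_le_iff\<close> speaks of.\<close>

lemma ennreal_leI_upper:
  fixes a b :: ennreal
  assumes "\<And>c. 0 \<le> c \<Longrightarrow> b \<le> ennreal c \<Longrightarrow> a \<le> ennreal c"
  shows "a \<le> b"
  by (cases b) (use assms in auto)

lemma rearr_mono_distr:
  assumes "\<And>c. 0 \<le> c \<Longrightarrow> distr_fun f c \<le> distr_fun g c"
  shows "rearr f x \<le> rearr g x"
  unfolding rearr_def distr_fun_def[symmetric]
proof (rule INF_superset_mono)
  show "{t. 0 \<le> t \<and> distr_fun g t \<le> ennreal x} \<subseteq> {t. 0 \<le> t \<and> distr_fun f t \<le> ennreal x}"
    using assms order_trans by blast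
qed simp

lemma antimono_rearr: "antimono (rearr f)"
proof (rule antimonoI)
  fix x y :: real assume "x \<le> y"
  then have "ennreal x \<le> ennreal y"
    by (rule ennreal_leI)
  then show "rearr f y \<le> rearr f x"
    unfolding rearr_def by (intro INF_superset_mono subsetI) (blast intro: order_trans, simp)
qed

section \<open>Measurability of monotone functions\<close>

lemma is_interval_antimono_superlevel:
  fixes f :: "real \<Rightarrow> 'a::linorder"
  assumes f: "antimono_on I f" and I: "is_interval I"
  shows "is_interval {x \<in> I. a < f x}"
  unfolding is_interval_1
proof (intro ballI allI impI)
  fix x y z
  assume x: "x \<in> {x \<in> I. a < f x}" and y: "y \<in> {x \<in> I. a < f x}" and z: "x \<le> z \<and> z \<le> y"
  then have "z \<in> I"
    using I unfolding is_interval_1 by blast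
  moreover from this have "f y \<le> f z"
    using y z f by (simp add: monotone_on_def)
  ultimately show "z \<in> {x \<in> I. a < f x}"
    using y order.strict_trans2[of a "f y" "f z"] by simp
qed

text \<open>Superlevel sets of a monotone function are intervals. This makes
  \<open>min 1 (b t)\<close> measurable, and also \<open>T_op b f\<close>, which inherits
  monotonicity from \<open>b\<close>.\<close>

lemma borel_measurable_antimono_half_line:
  fixes f :: "real \<Rightarrow> 'a::{linorder_topology, second_countable_topology}"
  assumes "antimono_on {0<..} f"
  shows "f \<in> borel_measurable half_line"
proof (rule borel_measurableI_greater)
  fix a
  let ?S = "{x \<in> space half_line. a < f x}"
  have "is_interval ?S"
    unfolding space_half_line
    by (rule is_interval_antimono_superlevel[OF assms]) (auto simp: is_interval_1)
  then have "?S \<in> sets lebesgue"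
    by (simp add: real_interval_borel_measurable)
  then show "?S \<in> sets half_line"
    by (subst sets_restrict_space_iff) auto
qed

text \<open>Borel measurability, rather than Lebesgue, allows integrating over \<open>lborel\<close>
  and substituting \<open>2 * s\<close> for \<open>s\<close>.\<close>

lemma borel_measurable_rearr [measurable]: "rearr f \<in> borel_measurable borel"
proof (rule borel_measurableI_greater)
  fix a
  have "is_interval {x \<in> space borel. a < rearr f x}"
    unfolding space_borel
    by (rule is_interval_antimono_superlevel[OF antimono_rearr]) (simp add: is_interval_1)
  then show "{x \<in> space borel. a < rearr f x} \<in> sets borel"
    by (rule real_interval_borel_measurable)
qed

section \<open>Order, scaling, sums and monotone limits of rearrangements\<close>

lemma rearr_abs [simp]: "rearr (\<lambda>x. \<bar>f x\<bar>) = rearr f"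
  by (simp add: rearr_def fun_eq_iff)

lemma rearr_mono:
  assumes f: "f \<in> meas_fun_nonneg" and g: "g \<in> meas_fun_nonneg"
    and le: "AE x in half_line. f x \<le> g x"
  shows "rearr f x \<le> rearr g x"
proof (rule rearr_mono_distr)
  fix c :: real
  show "distr_fun f c \<le> distr_fun g c"
    unfolding distr_fun_def
  proof (rule emeasure_mono_AE)
    show "AE s in half_line. s \<in> {s \<in> {0<..}. ereal c < \<bar>f s\<bar>} \<longrightarrow> s \<in> {s \<in> {0<..}. ereal c < \<bar>g s\<bar>}"
      using le
    proof eventually_elim
      case (elim s)
      then show ?case
        using meas_fun_nonnegD(2)[OF f, of s] meas_fun_nonnegD(2)[OF g, of s] by auto
    qed
  qed (use g meas_fun_nonnegD in auto)
qed

lemma rearr_eq_0: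
  assumes f: "f \<in> meas_fun" and z: "AE x in half_line. f x = 0"
  shows "rearr f x = 0"
proof -
  have "emeasure half_line {s \<in> space half_line. ereal 0 < \<bar>f s\<bar>} = 0"
    by (rule emeasure_eq_0_AE) (use z in \<open>auto elim!: eventually_mono\<close>)
  then have "distr_fun f 0 = 0"
    by (simp add: distr_fun_def)
  then have "rearr f x \<le> ennreal 0"
    by (subst rearr_le_iff[OF f]) auto
  then show ?thesis
    by simp
qed

text \<open>For \<open>a > 0\<close> the level set of the multiple at height \<open>c\<close> is
  that of \<open>f\<close> at height \<open>c / a\<close>, so both sides have the same real upper
  bounds.\<close>

lemma rearr_cmult:
  assumes f: "f \<in> meas_fun" and a: "0 \<le> a"
  shows "rearr (\<lambda>x. ereal a * f x) x = ennreal a * rearr f x"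
proof (cases "a = 0")
  \<comment> \<open>In \<open>ereal\<close> zero times an infinite value is zero, so the multiple is
    the zero function.\<close>
  case True
  have "(\<lambda>x. 0) \<in> meas_fun"
    by (simp add: meas_fun_def)
  then show ?thesis
    using True rearr_eq_0[of "\<lambda>x. 0"] by (simp add: zero_ereal_def[symmetric])
next
  case False
  with a have a: "a > 0"
    by simp
  have af: "(\<lambda>x. ereal a * f x) \<in> meas_fun"
    using f by (auto simp: meas_fun_def)
  have D: "distr_fun (\<lambda>x. ereal a * f x) c = distr_fun f (c / a)" for c
  proof -
    have "ereal c < \<bar>ereal a * f s\<bar> \<longleftrightarrow> ereal (c / a) < \<bar>f s\<bar>" for s
      by (cases "f s") (use a in \<open>auto simp: abs_mult field_simps\<close>)
    then show ?thesis
      by (simp add: distr_fun_def)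
  qed
  have *: "rearr (\<lambda>x. ereal a * f x) x \<le> ennreal c \<longleftrightarrow> ennreal a * rearr f x \<le> ennreal c"
    if c: "c \<ge> 0" for c
  proof -
    have "rearr (\<lambda>x. ereal a * f x) x \<le> ennreal c \<longleftrightarrow> rearr f x \<le> ennreal (c / a)"
      using a c by (simp add: rearr_le_iff af f D)
    also have "\<dots> \<longleftrightarrow> ennreal a * rearr f x \<le> ennreal c"
      by (cases "rearr f x")
        (use a c in \<open>auto simp: ennreal_mult[symmetric] ennreal_mult_top top_unique field_simps\<close>)
    finally show ?thesis .
  qed
  show ?thesis
    by (rule antisym; rule ennreal_leI_upper) (simp_all add: *)
qed

text \<open>Where \<open>f + g\<close> exceeds \<open>a + b\<close>, either \<open>f\<close> exceeds
  \<open>a\<close> or \<open>g\<close> exceeds \<open>b\<close>. With \<open>a\<close> and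
  \<open>b\<close> the values of the two rearrangements at \<open>x / 2\<close>, each of these sets
  has measure at most \<open>x / 2\<close>.\<close>

lemma rearr_add:
  assumes f: "f \<in> meas_fun_nonneg" and g: "g \<in> meas_fun_nonneg" and x: "0 \<le> x"
  shows "rearr (\<lambda>x. f x + g x) x \<le> rearr f (x / 2) + rearr g (x / 2)"
proof (cases "rearr f (x / 2) = top \<or> rearr g (x / 2) = top")
  case True
  then show ?thesis
    by auto
next
  case False
  then obtain a b where a: "a \<ge> 0" "rearr f (x / 2) = ennreal a"
    and b: "b \<ge> 0" "rearr g (x / 2) = ennreal b"
    by (metis ennreal_cases)
  note m [measurable] = meas_fun_nonnegD(1)[OF f] meas_fun_nonnegD(1)[OF g]
  have fg: "(\<lambda>x. f x + g x) \<in> meas_fun"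
    using m by (auto simp: meas_fun_def)
  have Df: "distr_fun f a \<le> ennreal (x / 2)" and Dg: "distr_fun g b \<le> ennreal (x / 2)"
    using rearr_le_iff[OF m(1) a(1), of "x / 2"] rearr_le_iff[OF m(2) b(1), of "x / 2"] a(2) b(2)
    by simp_all
  have "distr_fun (\<lambda>x. f x + g x) (a + b) \<le>
      emeasure half_line ({s \<in> {0<..}. ereal a < \<bar>f s\<bar>} \<union> {s \<in> {0<..}. ereal b < \<bar>g s\<bar>})"
    unfolding distr_fun_def
  proof (rule emeasure_mono)
    show "{s \<in> {0<..}. ereal (a + b) < \<bar>f s + g s\<bar>}
        \<subseteq> {s \<in> {0<..}. ereal a < \<bar>f s\<bar>} \<union> {s \<in> {0<..}. ereal b < \<bar>g s\<bar>}"
    proof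
      fix s assume s: "s \<in> {s \<in> {0<..}. ereal (a + b) < \<bar>f s + g s\<bar>}"
      have nn: "0 \<le> f s" "0 \<le> g s"
        using s f g by (auto dest: meas_fun_nonnegD)
      have "\<not> (f s \<le> ereal a \<and> g s \<le> ereal b)"
        using s nn add_mono[of "f s" "ereal a" "g s" "ereal b"] by auto
      then show "s \<in> {s \<in> {0<..}. ereal a < \<bar>f s\<bar>} \<union> {s \<in> {0<..}. ereal b < \<bar>g s\<bar>}"
        using s nn by auto
    qed
  qed (use m in \<open>auto intro!: sets.Un\<close>)
  also have "\<dots> \<le> distr_fun f a + distr_fun g b"
    unfolding distr_fun_def by (rule emeasure_subadditive) (use m in auto)
  also have "\<dots> \<le> ennreal (x / 2) + ennreal (x / 2)"
    by (rule add_mono[OF Df Dg])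
  also have "\<dots> = ennreal x"
    using x by (simp flip: ennreal_plus)
  finally have "rearr (\<lambda>x. f x + g x) x \<le> ennreal (a + b)"
    using a b by (simp only: rearr_le_iff[OF fg] add_nonneg_nonneg)
  then show ?thesis
    using a b by (simp add: ennreal_plus)
qed

text \<open>Up to null sets the level sets of the \<open>F j\<close> increase to that of
  \<open>f\<close>, so a measure bound common to all \<open>j\<close> survives in the limit;
  \<open>rearr_le_iff\<close> translates this into bounds on rearrangements.\<close>

lemma rearr_SUP:
  assumes F: "\<And>j::nat. F j \<in> meas_fun_nonneg" and f: "f \<in> meas_fun_nonneg"
    and lim: "AE x in half_line. incseq (\<lambda>j. F j x) \<and> (\<lambda>j. F j x) \<longlonglongrightarrow> f x"
  shows "incseq (\<lambda>j. rearr (F j) x)" "(SUP j. rearr (F j) x) = rearr f x"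
proof -
  note mF = meas_fun_nonnegD(1)[OF F] and mf = meas_fun_nonnegD(1)[OF f]
  show inc: "incseq (\<lambda>j. rearr (F j) x)"
  proof (rule incseq_SucI)
    show "rearr (F j) x \<le> rearr (F (Suc j)) x" for j
      by (rule rearr_mono[OF F F], use lim in eventually_elim) (auto simp: incseq_Suc_iff)
  qed
  have le: "rearr (F j) x \<le> rearr f x" for j
    by (rule rearr_mono[OF F f], use lim in eventually_elim) (auto intro: incseq_le)
  have "rearr f x \<le> (SUP j. rearr (F j) x)"
  proof (rule ennreal_leI_upper)
    fix c :: real assume c: "0 \<le> c" and "(SUP j. rearr (F j) x) \<le> ennreal c"
    then have "rearr (F j) x \<le> ennreal c" for j
      by (meson SUP_le_iff UNIV_I)
    then have D: "distr_fun (F j) c \<le> ennreal x" for j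
      using rearr_le_iff[OF mF c] by simp
    let ?A = "\<lambda>n. {s \<in> {0<..}. ereal c < \<bar>F n s\<bar>}"
    \<comment> \<open>The convergence is monotone only almost everywhere, so the sets
      \<open>?A n\<close> need not increase. Their finite unions do, and differ from
      \<open>?A n\<close> by null sets.\<close>
    let ?B = "\<lambda>n. \<Union>j\<le>n. ?A j"
    have "distr_fun f c \<le> emeasure half_line (\<Union>n. ?B n)"
      unfolding distr_fun_def
    proof (rule emeasure_mono_AE)
      show "AE s in half_line. s \<in> {s \<in> {0<..}. ereal c < \<bar>f s\<bar>} \<longrightarrow> s \<in> (\<Union>n. ?B n)"
        using lim
      proof eventually_elim
        case (elim s)
        show ?case
        proof
          assume s: "s \<in> {s \<in> {0<..}. ereal c < \<bar>f s\<bar>}"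
          then have "ereal c < f s"
            using meas_fun_nonnegD(2)[OF f, of s] by auto
          then have "eventually (\<lambda>n. ereal c < F n s) sequentially"
            using elim by (auto intro: order_tendstoD)
          then obtain n where "ereal c < F n s"
            by (auto simp: eventually_sequentially)
          then show "s \<in> (\<Union>n. ?B n)"
            using s meas_fun_nonnegD(2)[OF F, of s n] by (auto intro!: exI[of _ n] bexI[of _ n])
        qed
      qed
    qed (use mF in \<open>auto intro!: sets.countable_UN sets.finite_UN\<close>)
    also have "\<dots> = (SUP n. emeasure half_line (?B n))"
      by (rule SUP_emeasure_incseq[symmetric])
        (use mF in \<open>force simp: incseq_def intro!: sets.finite_UN\<close>)+
    also have "\<dots> \<le> (SUP n. emeasure half_line (?A n))"
    proof (intro SUP_mono' emeasure_mono_AE)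
      fix n
      show "AE s in half_line. s \<in> ?B n \<longrightarrow> s \<in> ?A n"
        using lim
      proof eventually_elim
        case (elim s)
        then have "F j s \<le> F n s" if "j \<le> n" for j
          using that by (auto simp: incseq_def)
        then show ?case
          using meas_fun_nonnegD(2)[OF F, of s] by (auto intro: order.strict_trans2)
      qed
    qed (use mF in auto)
    also have "\<dots> \<le> ennreal x"
      using D by (intro SUP_least) (simp add: distr_fun_def)
    finally show "rearr f x \<le> ennreal c"
      using rearr_le_iff[OF mf c] by simp
  qed
  moreover have "(SUP j. rearr (F j) x) \<le> rearr f x"
    by (rule SUP_least) (rule le)
  ultimately show "(SUP j. rearr (F j) x) = rearr f x"
    by (rule antisym[rotated])
qed

section \<open>The integral of the rearrangement as a function of its upper limit\<close>

definition T_enn :: "(real \<Rightarrow> ereal) \<Rightarrow> real \<Rightarrow> ennreal" where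
  "T_enn f u = (\<integral>\<^sup>+ s. rearr f s * indicator {0<..<u} s \<partial>lborel)"

text \<open>Lebesgue measure is the completion of \<open>lborel\<close>, and the integral of a Borel
  function is the same for both. Everything about \<open>T_op\<close> thus reduces to
  \<open>T_enn\<close> at a fixed upper limit.\<close>

lemma T_op_eq: "T_op b f t = enn2ereal (T_enn f (b t))"
  unfolding T_op_def T_enn_def by (simp add: nn_integral_completion)

lemma T_enn_mono_upper: "u \<le> v \<Longrightarrow> T_enn f u \<le> T_enn f v"
  unfolding T_enn_def by (intro nn_integral_mono) (auto split: split_indicator)

lemma T_enn_mono:
  assumes "\<And>x. 0 < x \<Longrightarrow> rearr f x \<le> rearr g x"
  shows "T_enn f u \<le> T_enn g u"
  unfolding T_enn_def by (intro nn_integral_mono) (use assms in \<open>auto split: split_indicator\<close>)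

lemma T_enn_cmult:
  assumes "f \<in> meas_fun" "0 \<le> a"
  shows "T_enn (\<lambda>x. ereal a * f x) u = ennreal a * T_enn f u"
  unfolding T_enn_def by (simp add: rearr_cmult assms mult.assoc nn_integral_cmult)

text \<open>The substitution produces the factor 2 and shrinks the interval to its left half, which
  is then enlarged again.\<close>

lemma T_enn_half:
  "(\<integral>\<^sup>+ s. rearr f (s / 2) * indicator {0<..<u} s \<partial>lborel) \<le> 2 * T_enn f u"
proof -
  have "(\<integral>\<^sup>+ s. rearr f (s / 2) * indicator {0<..<u} s \<partial>lborel) =
      2 * (\<integral>\<^sup>+ s. rearr f s * indicator {0<..<u} (2 * s) \<partial>lborel)"
    by (subst nn_integral_real_affine[where c = 2 and t = 0]) auto
  also have "\<dots> \<le> 2 * T_enn f u"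
    unfolding T_enn_def
    by (intro mult_left_mono nn_integral_mono) (auto split: split_indicator)
  finally show ?thesis .
qed

lemma T_enn_add:
  assumes f: "f \<in> meas_fun_nonneg" and g: "g \<in> meas_fun_nonneg"
  shows "T_enn (\<lambda>x. f x + g x) u \<le> 2 * (T_enn f u + T_enn g u)"
proof -
  have "T_enn (\<lambda>x. f x + g x) u \<le>
      (\<integral>\<^sup>+ s. rearr f (s / 2) * indicator {0<..<u} s + rearr g (s / 2) * indicator {0<..<u} s \<partial>lborel)"
    unfolding T_enn_def
    by (intro nn_integral_mono) (use rearr_add[OF f g] in \<open>auto split: split_indicator\<close>)
  also have "\<dots> = (\<integral>\<^sup>+ s. rearr f (s / 2) * indicator {0<..<u} s \<partial>lborel) +
      (\<integral>\<^sup>+ s. rearr g (s / 2) * indicator {0<..<u} s \<partial>lborel)"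
    by (rule nn_integral_add) measurable
  also have "\<dots> \<le> 2 * T_enn f u + 2 * T_enn g u"
    by (intro add_mono T_enn_half)
  finally show ?thesis
    by (simp add: distrib_left)
qed

text \<open>The rearrangements converge at every point, even though the \<open>F j\<close> converge
  only almost everywhere, so monotone convergence applies directly.\<close>

lemma T_enn_SUP:
  assumes F: "\<And>j::nat. F j \<in> meas_fun_nonneg" and f: "f \<in> meas_fun_nonneg"
    and lim: "AE x in half_line. incseq (\<lambda>j. F j x) \<and> (\<lambda>j. F j x) \<longlonglongrightarrow> f x"
  shows "incseq (\<lambda>j. T_enn (F j) u)" "(\<lambda>j. T_enn (F j) u) \<longlonglongrightarrow> T_enn f u"
proof -
  note S = rearr_SUP[OF F f lim]
  show inc: "incseq (\<lambda>j. T_enn (F j) u)"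
    using S(1) by (auto simp: incseq_def intro!: T_enn_mono)
  have "T_enn f u = (\<integral>\<^sup>+ s. (SUP j. rearr (F j) s * indicator {0<..<u} s) \<partial>lborel)"
    unfolding T_enn_def by (simp add: S(2)[symmetric] SUP_mult_right_ennreal)
  also have "\<dots> = (SUP j. T_enn (F j) u)"
    unfolding T_enn_def
    by (rule nn_integral_monotone_convergence_SUP)
      (use S(1) in \<open>auto simp: incseq_def le_fun_def intro!: mult_right_mono\<close>)
  finally show "(\<lambda>j. T_enn (F j) u) \<longlonglongrightarrow> T_enn f u"
    using LIMSEQ_SUP[OF inc] by simp
qed

text \<open>A nonincreasing function whose integral over an initial interval vanishes has no nonzero
  value on the positive half-line.\<close>

lemma T_enn_eq_0_iff:
  assumes f: "f \<in> meas_fun" and u: "0 < u"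
  shows "T_enn f u = 0 \<longleftrightarrow> (AE x in half_line. f x = 0)"
proof
  assume "AE x in half_line. f x = 0"
  then show "T_enn f u = 0"
    using rearr_eq_0[OF f] by (simp add: T_enn_def)
next
  assume "T_enn f u = 0"
  then have AE0: "AE s in lborel. rearr f s * indicator {0<..<u} s = 0"
    unfolding T_enn_def by (subst (asm) nn_integral_0_iff_AE) auto
  have small: "rearr f e = 0" if e: "0 < e" for e
  proof (rule ccontr)
    assume "rearr f e \<noteq> 0"
    then have pos: "rearr f s \<noteq> 0" if "s \<le> e" for s
      using antimonoD[OF antimono_rearr that, of f] by auto
    have "AE s in lborel. s \<notin> {0<..<min e u}"
      using AE0 by eventually_elim (use pos in \<open>auto split: split_indicator_asm\<close>)
    then have "emeasure lborel {0<..<min e u} = 0"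
      by (subst (asm) AE_iff_measurable[where N = "{0<..<min e u}"]) auto
    then show False
      using e u by simp
  qed
  \<comment> \<open>By the inverse relation, vanishing of the rearrangement at \<open>e\<close>
    bounds the measure of the set where \<open>f\<close> is nonzero by \<open>e\<close>, for every
    \<open>e > 0\<close>.\<close>
  have "distr_fun f 0 \<le> 0"
  proof (rule ennreal_le_epsilon)
    fix e :: real assume "0 < e"
    then show "distr_fun f 0 \<le> 0 + ennreal e"
      using rearr_le_iff[OF f, of 0 e] small by simp
  qed
  then have "{s \<in> {0<..}. ereal 0 < \<bar>f s\<bar>} \<in> null_sets half_line"
    using f by (simp add: distr_fun_def null_sets_def)
  then have "AE s in half_line. s \<notin> {s \<in> {0<..}. ereal 0 < \<bar>f s\<bar>}"
    by (rule AE_not_in)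
  moreover have "AE s in half_line. s > 0"
    by (rule AE_half_lineI)
  ultimately show "AE x in half_line. f x = 0"
  proof eventually_elim
    case (elim s)
    then show ?case
      by (cases "f s") auto
  qed
qed

section \<open>Indicator functions\<close>

lemma indicator_meas_fun_nonneg: "G \<in> sets half_line \<Longrightarrow> indicator G \<in> meas_fun_nonneg"
  by (auto simp: meas_fun_nonneg_def meas_fun_def)

text \<open>The rearrangement is at most 1 and vanishes from \<open>m\<close> on. Having
  \<open>m\<close> only as an upper bound for the measure lets it be taken at least 1 later.\<close>

lemma T_enn_indicator_le:
  assumes G: "G \<in> sets half_line" and m: "emeasure half_line G \<le> ennreal m" and "0 \<le> m" "0 \<le> u"
  shows "T_enn (indicator G) u \<le> ennreal (min m u)"
proof -
  note i = meas_fun_nonnegD(1)[OF indicator_meas_fun_nonneg[OF G]]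
  have sub: "G \<subseteq> {0<..}"
    using sets.sets_into_space[OF G] by simp
  have "{s \<in> {0<..}. ereal 1 < \<bar>indicator G s\<bar>} = {}"
    by (auto split: split_indicator_asm simp: one_ereal_def)
  then have "distr_fun (indicator G) 1 = 0"
    unfolding distr_fun_def by (simp only: emeasure_empty)
  then have le1: "rearr (indicator G) s \<le> 1" for s
    using rearr_le_iff[OF i, of 1 s] by simp
  have "{s \<in> {0<..}. ereal 0 < \<bar>indicator G s\<bar>} = G"
    using sub by (auto split: split_indicator_asm simp: one_ereal_def)
  then have "distr_fun (indicator G) 0 \<le> ennreal m"
    unfolding distr_fun_def using m by (simp only:)
  then have le0: "rearr (indicator G) s = 0" if "m \<le> s" for s
    using rearr_le_iff[OF i, of 0 s] order_trans[OF _ ennreal_leI[OF that]] by simp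
  have "T_enn (indicator G) u \<le> (\<integral>\<^sup>+ s. indicator {0<..<min m u} s \<partial>lborel)"
    unfolding T_enn_def
    by (intro nn_integral_mono) (use le0 le1 in \<open>auto split: split_indicator simp: not_less\<close>)
  also have "\<dots> = ennreal (min m u)"
    using assms by simp
  finally show ?thesis .
qed

text \<open>For \<open>0 \<le> t < 1\<close> the level set at height \<open>t\<close> is the whole
  unit interval, of measure 1, so no such \<open>t\<close> competes in the infimum at a point
  \<open>s < 1\<close>.\<close>

lemma T_enn_indicator_ge:
  assumes "0 \<le> u"
  shows "ennreal (min 1 u) \<le> T_enn (indicator {0<..<1}) u"
proof -
  have "1 \<le> rearr (indicator {0<..<1}) s" if s: "0 < s" "s < 1" for s
    unfolding rearr_def
  proof (rule INF_greatest)
    fix t assume "t \<in> {t. 0 \<le> t \<and> emeasure half_line {s \<in> {0<..}. ereal t < \<bar>indicator {0<..<1} s\<bar>} \<le> ennreal s}"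
    then have t: "0 \<le> t" "emeasure half_line {s \<in> {0<..}. ereal t < \<bar>indicator {0<..<1} s\<bar>} \<le> ennreal s"
      by auto
    show "1 \<le> ennreal t"
    proof (rule ccontr)
      assume "\<not> 1 \<le> ennreal t"
      then have "t < 1"
        using t(1) by (metis ennreal_1 ennreal_leI not_less)
      then have "{s \<in> {0<..}. ereal t < \<bar>indicator {0<..<1} s\<bar>} = {0<..<1}"
        using t(1) by (auto split: split_indicator_asm simp: one_ereal_def zero_ereal_def)
      moreover have "emeasure half_line {0<..<1} = 1"
        by (subst emeasure_restrict_space) auto
      ultimately show False
        using t(2) s by (metis ennreal_1 ennreal_less_iff less_eq_real_def linorder_not_less)
    qed
  qed
  then have "(\<integral>\<^sup>+ s. indicator {0<..<min 1 u} s \<partial>lborel) \<le> T_enn (indicator {0<..<1}) u"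
    unfolding T_enn_def
    by (intro nn_integral_mono) (auto split: split_indicator)
  then show ?thesis
    using assms by simp
qed

section \<open>The functional that sends \<open>f\<close> to \<open>\<rho> (T_op b f)\<close> is a
  rearrangement-invariant quasinorm\<close>

lemma T_op_meas_fun_nonneg:
  assumes "antimono_on {0<..} b"
  shows "T_op b f \<in> meas_fun_nonneg"
proof -
  have "antimono_on {0<..} (T_op b f)"
    using assms T_enn_mono_upper
    by (fastforce simp: monotone_on_def T_op_eq less_eq_ennreal.rep_eq[symmetric])
  then have "T_op b f \<in> borel_measurable half_line"
    by (rule borel_measurable_antimono_half_line)
  then show ?thesis
    by (simp add: meas_fun_nonneg_def meas_fun_def T_op_eq)
qed

text \<open>A locale lets the same named rules serve both the quasinorm of \<open>Y\<close> and that
  of an arbitrary domain partner.\<close>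

locale ri_qnorm =
  fixes \<rho> :: "(real \<Rightarrow> ereal) \<Rightarrow> ennreal"
  assumes ri: "ri_quasinorm \<rho>"
begin

lemma eq_0_iff: "f \<in> meas_fun_nonneg \<Longrightarrow> \<rho> f = 0 \<longleftrightarrow> (AE x in half_line. f x = 0)"
  using ri unfolding ri_quasinorm_def by blast

lemma cmult: "f \<in> meas_fun_nonneg \<Longrightarrow> 0 \<le> a \<Longrightarrow> \<rho> (\<lambda>x. ereal a * f x) = ennreal a * \<rho> f"
  using ri unfolding ri_quasinorm_def by blast

lemma quasi_triangle:
  obtains C :: real where "1 \<le> C"
    "\<And>f g. f \<in> meas_fun_nonneg \<Longrightarrow> g \<in> meas_fun_nonneg \<Longrightarrow>
      \<rho> (\<lambda>x. f x + g x) \<le> ennreal C * (\<rho> f + \<rho> g)"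
proof -
  have "\<exists>C::real. 1 \<le> C \<and> (\<forall>f\<in>meas_fun_nonneg. \<forall>g\<in>meas_fun_nonneg.
        \<rho> (\<lambda>x. f x + g x) \<le> ennreal C * (\<rho> f + \<rho> g))"
    using ri unfolding ri_quasinorm_def by (elim conjE)
  then show thesis
    using that by auto
qed

lemma mono:
  "f \<in> meas_fun_nonneg \<Longrightarrow> g \<in> meas_fun_nonneg \<Longrightarrow> AE x in half_line. f x \<le> g x \<Longrightarrow> \<rho> f \<le> \<rho> g"
  using ri unfolding ri_quasinorm_def by blast

lemma mono_conv:
  assumes "\<And>j::nat. F j \<in> meas_fun_nonneg" "f \<in> meas_fun_nonneg"
    "AE x in half_line. incseq (\<lambda>j. F j x) \<and> (\<lambda>j. F j x) \<longlonglongrightarrow> f x"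
  shows "incseq (\<lambda>j. \<rho> (F j)) \<and> (\<lambda>j. \<rho> (F j)) \<longlonglongrightarrow> \<rho> f"
  using ri assms unfolding ri_quasinorm_def by blast

lemma indicator_finite:
  "G \<in> sets half_line \<Longrightarrow> emeasure half_line G < \<infinity> \<Longrightarrow> \<rho> (indicator G) < \<infinity>"
  using ri unfolding ri_quasinorm_def by blast

end

lemma ereal_mult_enn2ereal: "0 \<le> a \<Longrightarrow> ereal a * enn2ereal x = enn2ereal (ennreal a * x)"
  by (simp add: times_ennreal.rep_eq enn2ereal_ennreal)

text \<open>Each axiom combines the matching axiom for \<open>\<rho>\<close> with a property of
  \<open>T_enn\<close> that holds at every upper limit. That \<open>b\<close> is not identically
  zero gives definiteness; finiteness of the quasinorm of \<open>min 1 (b t)\<close> gives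
  finiteness on indicators.\<close>

lemma ri_quasinorm_T_op:
  assumes b0: "\<forall>t>0. 0 \<le> b t" and b: "antimono_on {0<..} b" and bnz: "\<exists>t>0. b t \<noteq> 0"
    and ri: "ri_quasinorm \<rho>"
    and min_b: "(\<lambda>t. ereal (min 1 (b t))) \<in> meas_fun_nonneg" "\<rho> (\<lambda>t. ereal (min 1 (b t))) < \<infinity>"
  shows "ri_quasinorm (\<lambda>f. \<rho> (T_op b f))"
proof -
  interpret ri_qnorm \<rho>
    by standard (rule ri)
  note T = T_op_meas_fun_nonneg[OF b]
  have zero: "\<rho> (T_op b f) = 0 \<longleftrightarrow> (AE x in half_line. f x = 0)" if "f \<in> meas_fun_nonneg" for f
  proof -
    note mf = meas_fun_nonnegD(1)[OF that]
    obtain t0 where t0: "t0 > 0" "b t0 > 0"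
      using bnz b0 by (metis order_less_le)
    \<comment> \<open>Monotonicity spreads positivity from \<open>t0\<close> to all smaller
      arguments, a set of positive measure on which \<open>T_op b f\<close> would have to vanish
      almost everywhere.\<close>
    have pos: "b t > 0" if "0 < t" "t \<le> t0" for t
      using b that t0 by (auto simp: monotone_on_def intro: order.strict_trans2)
    show ?thesis
      unfolding eq_0_iff[OF T]
    proof
      assume f0: "AE x in half_line. f x = 0"
      show "AE x in half_line. T_op b f x = 0"
        using rearr_eq_0[OF mf f0] by (simp add: T_op_eq T_enn_def zero_ennreal.rep_eq)
    next
      assume AE0: "AE x in half_line. T_op b f x = 0"
      show "AE x in half_line. f x = 0"
      proof (rule ccontr)
        assume nz: "\<not> (AE x in half_line. f x = 0)"
        have "T_op b f t \<noteq> 0" if "0 < t" "t \<le> t0" for t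
          using T_enn_eq_0_iff[OF mf pos[OF that]] nz
          by (metis T_op_eq enn2ereal_inject zero_ennreal.rep_eq)
        then have "AE t in half_line. t \<notin> {0<..<t0}"
          using AE0 by (auto elim!: eventually_mono)
        then have "emeasure half_line {0<..<t0} = 0"
          by (subst (asm) AE_iff_measurable[where N = "{0<..<t0}"]) (auto simp: sets_restrict_space_iff)
        moreover have "emeasure half_line {0<..<t0} = ennreal t0"
          using t0 by (subst emeasure_restrict_space) auto
        ultimately show False
          using t0 by simp
      qed
    qed
  qed
  have hom: "\<rho> (T_op b (\<lambda>x. ereal a * f x)) = ennreal a * \<rho> (T_op b f)"
    if "f \<in> meas_fun_nonneg" "0 \<le> a" for f a
  proof -
    have "T_op b (\<lambda>x. ereal a * f x) = (\<lambda>t. ereal a * T_op b f t)"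
      using that by (simp add: fun_eq_iff T_op_eq T_enn_cmult meas_fun_nonnegD ereal_mult_enn2ereal)
    then show ?thesis
      using cmult[OF T] that by simp
  qed
  have tri: "\<exists>C::real. 1 \<le> C \<and> (\<forall>f\<in>meas_fun_nonneg. \<forall>g\<in>meas_fun_nonneg.
        \<rho> (T_op b (\<lambda>x. f x + g x)) \<le> ennreal C * (\<rho> (T_op b f) + \<rho> (T_op b g)))"
  proof -
    obtain C where C: "1 \<le> C" "\<And>f g. f \<in> meas_fun_nonneg \<Longrightarrow> g \<in> meas_fun_nonneg \<Longrightarrow>
        \<rho> (\<lambda>x. f x + g x) \<le> ennreal C * (\<rho> f + \<rho> g)"
      using quasi_triangle by blast
    \<comment> \<open>The factor 2 comes from \<open>T_enn_add\<close>, the factor \<open>C\<close>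
      from the quasi-triangle inequality for \<open>\<rho>\<close>.\<close>
    have "\<rho> (T_op b (\<lambda>x. f x + g x)) \<le> ennreal (2 * C) * (\<rho> (T_op b f) + \<rho> (T_op b g))"
      if f: "f \<in> meas_fun_nonneg" and g: "g \<in> meas_fun_nonneg" for f g
    proof -
      have sum: "(\<lambda>t. T_op b f t + T_op b g t) \<in> meas_fun_nonneg"
        using T[of f] T[of g] by (auto simp: meas_fun_nonneg_def meas_fun_def)
      then have sum2: "(\<lambda>t. ereal 2 * (T_op b f t + T_op b g t)) \<in> meas_fun_nonneg"
        by (auto simp: meas_fun_nonneg_def meas_fun_def)
      have "T_op b (\<lambda>x. f x + g x) t \<le> ereal 2 * (T_op b f t + T_op b g t)" for t
        using T_enn_add[OF f g, of "b t"]
        by (simp add: T_op_eq plus_ennreal.rep_eq[symmetric] ereal_mult_enn2ereal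
            less_eq_ennreal.rep_eq[symmetric] del: numeral_eq_ereal)
      then have "\<rho> (T_op b (\<lambda>x. f x + g x)) \<le> \<rho> (\<lambda>t. ereal 2 * (T_op b f t + T_op b g t))"
        by (intro mono T sum2 AE_I2)
      also have "\<dots> = ennreal 2 * \<rho> (\<lambda>t. T_op b f t + T_op b g t)"
        by (rule cmult[OF sum]) simp
      also have "\<dots> \<le> ennreal 2 * (ennreal C * (\<rho> (T_op b f) + \<rho> (T_op b g)))"
        by (intro mult_left_mono C T) simp
      also have "\<dots> = ennreal (2 * C) * (\<rho> (T_op b f) + \<rho> (T_op b g))"
        using C(1) by (subst ennreal_mult) (simp_all add: mult.assoc)
      finally show ?thesis .
    qed
    then show ?thesis
      using C(1) by (intro exI[of _ "2 * C"]) auto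
  qed
  have mon: "\<rho> (T_op b f) \<le> \<rho> (T_op b g)"
    if "f \<in> meas_fun_nonneg" "g \<in> meas_fun_nonneg" "AE x in half_line. f x \<le> g x" for f g
    using T_enn_mono[OF rearr_mono[OF that]]
    by (intro mono T AE_I2) (simp add: T_op_eq less_eq_ennreal.rep_eq[symmetric])
  have conv: "incseq (\<lambda>j. \<rho> (T_op b (F j))) \<and> (\<lambda>j. \<rho> (T_op b (F j))) \<longlonglongrightarrow> \<rho> (T_op b f)"
    if "\<And>j::nat. F j \<in> meas_fun_nonneg" "f \<in> meas_fun_nonneg"
      "AE x in half_line. incseq (\<lambda>j. F j x) \<and> (\<lambda>j. F j x) \<longlonglongrightarrow> f x" for F f
    using T_enn_SUP[OF that]
    by (intro mono_conv T AE_I2)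
      (auto simp: T_op_eq incseq_def less_eq_ennreal.rep_eq[symmetric] intro!: tendsto_enn2erealI)
  have ind: "\<rho> (T_op b (indicator G)) < \<infinity>"
    if G: "G \<in> sets half_line" and fin: "emeasure half_line G < \<infinity>" for G
  proof -
    obtain r where r: "0 \<le> r" "emeasure half_line G = ennreal r"
      using fin by (cases "emeasure half_line G") auto
    \<comment> \<open>The bound \<open>min m (b t) \<le> m * min 1 (b t)\<close> below needs
      \<open>m \<ge> 1\<close>: for \<open>0 < m < 1\<close> it fails at
      \<open>b t = m\<close>.\<close>
    define m where "m = max 1 r"
    have m: "1 \<le> m" "emeasure half_line G \<le> ennreal m"
      unfolding m_def by (simp_all add: r ennreal_leI)
    have m_b: "(\<lambda>t. ereal m * ereal (min 1 (b t))) \<in> meas_fun_nonneg"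
      using min_b(1) m by (auto simp: meas_fun_nonneg_def meas_fun_def)
    have "T_op b (indicator G) t \<le> ereal m * ereal (min 1 (b t))" if t: "0 < t" for t
    proof -
      have bt: "0 \<le> b t"
        using b0 t by blast
      have "min m (b t) \<le> m * min 1 (b t)"
        using m bt mult_right_mono[of 1 m "b t"] by (auto simp: min_def)
      with T_enn_indicator_le[OF G m(2) _ bt] m
      have "T_enn (indicator G) (b t) \<le> ennreal (m * min 1 (b t))"
        by (meson order_trans ennreal_leI zero_le_one)
      then show ?thesis
        using m bt by (simp add: T_op_eq less_eq_ennreal.rep_eq enn2ereal_ennreal del: ereal_min)
    qed
    then have "\<rho> (T_op b (indicator G)) \<le> \<rho> (\<lambda>t. ereal m * ereal (min 1 (b t)))"
      by (intro mono T m_b AE_half_lineI)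
    also have "\<dots> = ennreal m * \<rho> (\<lambda>t. ereal (min 1 (b t)))"
      by (rule cmult[OF min_b(1)]) (use m in simp)
    also have "\<dots> < \<infinity>"
      using min_b(2) by (simp add: ennreal_mult_less_top)
    finally show ?thesis .
  qed
  have eq: "\<rho> (T_op b f) = \<rho> (T_op b g)" if "\<forall>x\<ge>0. rearr f x = rearr g x" for f g
  proof -
    have "T_op b f = T_op b g"
      using that by (auto simp: fun_eq_iff T_op_eq intro!: arg_cong[where f = enn2ereal] antisym T_enn_mono)
    then show ?thesis
      by simp
  qed
  show ?thesis
    unfolding ri_quasinorm_def
    by (intro conjI ballI allI impI zero hom tri mon conv[THEN conjunct1] conv[THEN conjunct2] ind eq) auto
qed

section \<open>Optimality, and the obstruction to domain partners\<close>

theorem theorem4p9: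
  fixes b :: "real \<Rightarrow> real" and Y :: fun_space
  assumes "\<forall>t>0. 0 \<le> b t"
    and "antimono_on {0<..} b"
    and "\<exists>t>0. b t \<noteq> 0"
    and "qri_space Y"
  shows "((\<lambda>t. ereal (min 1 (b t))) \<in> space_set Y \<longrightarrow>
            bounded_between (T_op b) (Upsilon b Y) Y \<and>
            optimal_domain_partner (T_op b) Y (Upsilon b Y)) \<and>
         ((\<lambda>t. ereal (min 1 (b t))) \<notin> space_set Y \<longrightarrow>
            \<not> (\<exists>X. domain_partner (T_op b) Y X))"
proof -
  obtain \<rho> where \<rho>: "ri_quasinorm \<rho>" and
    Y_set: "space_set Y = {f \<in> meas_fun. \<rho> (\<lambda>x. \<bar>f x\<bar>) < \<infinity>}" and
    Y_norm: "\<And>f. f \<in> meas_fun \<Longrightarrow> space_norm Y f = \<rho> (\<lambda>x. \<bar>f x\<bar>)"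
    using assms(4) unfolding qri_space_def by blast
  interpret Y: ri_qnorm \<rho>
    by standard (rule \<rho>)
  note T = T_op_meas_fun_nonneg[OF assms(2)]
  have norm_T: "space_norm Y (T_op b f) = \<rho> (T_op b f)" for f
    using Y_norm[OF meas_fun_nonnegD(1)[OF T], of f] by (simp add: T_op_eq[abs_def])
  let ?m = "\<lambda>t. ereal (min 1 (b t))"
  have "antimono_on {0<..} ?m"
    using assms(2) by (auto simp: monotone_on_def min_le_iff_disj)
  then have m: "?m \<in> meas_fun_nonneg"
    using assms(1) borel_measurable_antimono_half_line[of ?m]
    by (simp add: meas_fun_nonneg_def meas_fun_def)
  have abs_m: "(\<lambda>t. \<bar>?m t\<bar>) \<in> meas_fun_nonneg"
    using m by (auto simp: meas_fun_nonneg_def meas_fun_def)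
  \<comment> \<open>\<open>b\<close> may be negative outside the half-line, so the two functions agree only almost everywhere.\<close>
  have "\<rho> (\<lambda>t. \<bar>?m t\<bar>) = \<rho> ?m"
    by (rule antisym; rule Y.mono) (use m abs_m assms(1) in \<open>auto intro!: AE_half_lineI\<close>)
  then have m_iff: "?m \<in> space_set Y \<longleftrightarrow> \<rho> ?m < \<infinity>"
    using meas_fun_nonnegD(1)[OF m] by (simp add: Y_set)
  have bdd: "bounded_between (T_op b) (Upsilon b Y) Y"
    unfolding bounded_between_def Upsilon_def by (auto intro!: exI[of _ 1])
  have "optimal_domain_partner (T_op b) Y (Upsilon b Y)" if "?m \<in> space_set Y"
  proof -
    have "ri_quasinorm (\<lambda>f. \<rho> (T_op b f))"
      by (rule ri_quasinorm_T_op) (use assms \<rho> m m_iff that in auto)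
    \<comment> \<open>The definition of \<open>qri_space\<close> evaluates the quasinorm at
      \<open>\<bar>f\<bar>\<close>, whereas \<open>Upsilon\<close> uses \<open>f\<close> itself; the
      rearrangement does not distinguish them.\<close>
    moreover have "T_op b (\<lambda>x. \<bar>f x\<bar>) = T_op b f" for f
      by (simp add: T_op_def)
    ultimately have "qri_space (Upsilon b Y)"
      unfolding qri_space_def Upsilon_def
      by (intro exI[of _ "\<lambda>f. \<rho> (T_op b f)"]) (simp add: norm_T)
    \<comment> \<open>Boundedness from \<open>Z\<close> to \<open>Y\<close> and the embedding are
      the same inequality, with the same constant.\<close>
    moreover have "embeds Z (Upsilon b Y)" if "domain_partner (T_op b) Y Z" for Z
      using that unfolding domain_partner_def bounded_between_def embeds_def Upsilon_def by simp
    ultimately show ?thesis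
      using bdd by (simp add: optimal_domain_partner_def domain_partner_def)
  qed
  \<comment> \<open>The contrapositive of the last claim: the indicator of the unit interval lies in
    every candidate \<open>X\<close>, and its image under \<open>T_op b\<close> dominates
    \<open>?m\<close>.\<close>
  moreover have "?m \<in> space_set Y" if partner: "domain_partner (T_op b) Y X" for X
  proof -
    obtain \<sigma> where \<sigma>: "ri_quasinorm \<sigma>" and
      X_set: "space_set X = {f \<in> meas_fun. \<sigma> (\<lambda>x. \<bar>f x\<bar>) < \<infinity>}" and
      X_norm: "\<And>f. f \<in> meas_fun \<Longrightarrow> space_norm X f = \<sigma> (\<lambda>x. \<bar>f x\<bar>)"
      using partner unfolding domain_partner_def qri_space_def by blast
    interpret X: ri_qnorm \<sigma>
      by standard (rule \<sigma>)
    obtain C :: real where C: "\<And>f. f \<in> space_set X \<Longrightarrow> space_norm Y (T_op b f) \<le> ennreal C * space_norm X f"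
      using partner unfolding domain_partner_def bounded_between_def by blast
    let ?i = "indicator {0<..<1::real} :: real \<Rightarrow> ereal"
    have I: "{0<..<1::real} \<in> sets half_line"
      by (subst sets_restrict_space_iff) auto
    have I_fin: "emeasure half_line {0<..<1::real} < \<infinity>"
      by (subst emeasure_restrict_space) auto
    note i = meas_fun_nonnegD(1)[OF indicator_meas_fun_nonneg[OF I]]
    have abs_i: "(\<lambda>x. \<bar>?i x\<bar>) = ?i"
      by (auto simp: fun_eq_iff split: split_indicator)
    have i_fin: "\<sigma> ?i < \<infinity>"
      by (rule X.indicator_finite[OF I I_fin])
    have "?m t \<le> T_op b ?i t" if "0 < t" for t
      using T_enn_indicator_ge[of "b t"] assms(1) that
      by (simp add: T_op_eq less_eq_ennreal.rep_eq enn2ereal_ennreal)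
    then have "\<rho> ?m \<le> \<rho> (T_op b ?i)"
      by (intro Y.mono m T AE_half_lineI)
    also have "\<dots> \<le> ennreal C * \<sigma> ?i"
      using C[of ?i] i i_fin by (simp add: norm_T X_set X_norm abs_i)
    also have "\<dots> < \<infinity>"
      using i_fin by (simp add: ennreal_mult_less_top)
    finally show ?thesis
      unfolding m_iff .
  qed
  ultimately show ?thesis
    using bdd by blast
qed

end
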